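(* Let $0<r_0<1$ and let $m:[r_0,1)\to\mathbb R$ be an increasing continuous function that has at every point $r\in[r_0,1)$ a right derivative $m'_{\mathrm{right}}(r)$ which is right-continuous, and such that the function $r\mapsto r\,m'_{\mathrm{right}}(r)$ is increasing. Let $f\not\equiv0$ be a holomorphic function on the unit disc $\mathbb D$ that vanishes on a sequence $\mathtt Z=\{\mathtt z_k\}_{k=1,2,\dots}\subset\mathbb D$, and suppose $\log|f(z)|\le m(|z|)$ for all $z\in\mathbb D$ with $|z|\ge r_0$. Then for every number $b\ge0$ there exist constants $C\ge0$, depending only on $r_0,b$, and $\overline C_m\ge0$, depending only on $r_0,b,m$, such that for every $d\in\mathrm{decr}^+[r_0,1;\le b)$ $$\sum_{r_0\le|\mathtt z_k|<1}\int_{|\mathtt z_k|}^1\frac{d(t)}t\,dt\le\int_{r_0}^1d(t)\,m'_{\mathrm{right}}(t)\,dt+C\,\overline C_m-C\log|f(0)|,$$ and the constant $\overline C_m$ is positively homogeneous and subadditive in $m$.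
   Context: $\mathbb D=\{z\in\mathbb C:|z|<1\}$. Positive means $\ge0$; increasing/decreasing are non-strict. For $b\ge0$, $\mathrm{decr}^+[r_0,1;\le b)$ is the class of all positive decreasing functions $d:[r_d,1)\to\mathbb R$, with some $r_d\in(0,r_0)$ depending on $d$, such that $\int_{r_0}^1\frac{d(t)}t\,dt\le b$. A holomorphic $f\not\equiv0$ vanishes on $\mathtt Z$ if at each point $z$ the multiplicity of the zero of $f$ is at least the number of repetitions of $z$ in $\mathtt Z$. If $f(0)=0$ the right-hand side is understood as $+\infty$. Positively homogeneous: $\overline C_{am}=a\overline C_m$ for $a\ge0$; subadditive: $\overline C_{m_1+m_2}\le\overline C_{m_1}+\overline C_{m_2}$. *)

theory Defs
  imports "HOL-Complex_Analysis.Complex_Analysis"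
begin

text \<open>Functions on \<open>[r\<^sub>0, 1)\<close> are modelled by total functions whose values outside that
  interval are irrelevant; in particular, for \<open>r\<close> in the interval, the right derivative only
  depends on \<open>m r\<close> and the values of \<open>m\<close> immediately to the right of \<open>r\<close>.\<close>

definition right_deriv :: "(real \<Rightarrow> real) \<Rightarrow> real \<Rightarrow> real" where
  "right_deriv m r = (THE D. (m has_real_derivative D) (at_right r))"

definition admissible_majorant :: "real \<Rightarrow> (real \<Rightarrow> real) \<Rightarrow> bool" where
  "admissible_majorant r0 m \<longleftrightarrow>
     mono_on {r0..<1} m \<and>
     continuous_on {r0..<1} m \<and>
     (\<forall>r\<in>{r0..<1}. \<exists>D. (m has_real_derivative D) (at_right r)) \<and>
     (\<forall>r\<in>{r0..<1}. continuous (at_right r) (right_deriv m)) \<and>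
     mono_on {r0..<1} (\<lambda>r. r * right_deriv m r)"

text \<open>Integrals of positive functions are taken in \<open>[0, \<infinity>]\<close>.\<close>

definition weight_tail :: "(real \<Rightarrow> real) \<Rightarrow> real \<Rightarrow> ennreal" where
  "weight_tail d r = (\<integral>\<^sup>+t\<in>{r..<1}. ennreal (d t / t) \<partial>lborel)"

definition decr_plus :: "real \<Rightarrow> real \<Rightarrow> (real \<Rightarrow> real) set" where
  "decr_plus r0 b =
     {d. (\<exists>rd. 0 < rd \<and> rd < r0 \<and> (\<forall>t\<in>{rd..<1}. 0 \<le> d t) \<and> antimono_on {rd..<1} d) \<and>
         weight_tail d r0 \<le> ennreal b}"

text \<open>A sequence of points of the disc, finite or infinite, is a function \<open>Z\<close> on an index
  set \<open>K\<close> that is either \<open>{1, 2, \<dots>}\<close> or \<open>{1, \<dots>, n}\<close>.\<close>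

definition disc_sequence :: "nat set \<Rightarrow> (nat \<Rightarrow> complex) \<Rightarrow> bool" where
  "disc_sequence K Z \<longleftrightarrow> (K = {1..} \<or> (\<exists>n. K = {1..n})) \<and> (\<forall>k\<in>K. Z k \<in> ball 0 1)"

text \<open>Meant for \<open>f\<close> holomorphic and not identically zero on the disc, where \<open>zorder f w\<close> is
  the multiplicity of the zero of \<open>f\<close> at \<open>w\<close> (and is \<open>0\<close> if \<open>f w \<noteq> 0\<close>).  Finiteness has to be
  required because \<open>card\<close> of an infinite set is \<open>0\<close>.\<close>

definition vanishes_on :: "(complex \<Rightarrow> complex) \<Rightarrow> nat set \<Rightarrow> (nat \<Rightarrow> complex) \<Rightarrow> bool" where
  "vanishes_on f K Z \<longleftrightarrow>
     (\<forall>w\<in>ball 0 1. finite {k\<in>K. Z k = w} \<and> int (card {k\<in>K. Z k = w}) \<le> zorder f w)"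

text \<open>\<open>log |w|\<close> with \<open>log 0 = -\<infinity>\<close>.\<close>

definition log_abs :: "complex \<Rightarrow> ereal" where
  "log_abs w = (if w = 0 then -\<infinity> else ereal (ln (cmod w)))"

end

(* Dividing out the zeros of f inside |z| < s as in Jensen's inequality bounds
   sum ln (s / |Z k|), which is the integral of n(t) / t up to s (n the counting function of the
   zeros), by m s - ln |f 0|; and m s - m r is at most the integral of the right derivative of m.
   Integrating these bounds over [r1, s) against the decreasing weight d gives the estimate over
   [r1, 1) up to the boundary term d r1 * (m r1 - ln |f 0|).  The value d r0 is not controlled
   by b, so one starts at some r1 > r0: there d r1 * ln (r1 / r0) <= b, and the part over
   [r0, r1) costs at most b for each zero in |z| < r1, of which there are at most
   (m r2 - ln |f 0|) / ln (r2 / r1).  Hence max 0 (m r2) can serve as the constant for m. *)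

theory Submission
  imports Defs
begin

section \<open>Dividing out zeros and Jensen's inequality\<close>

text \<open>One linear factor is split off per index. The multiplicity hypothesis forces the
  cofactor obtained so far to vanish at the next point, even when that point has occurred
  before.\<close>

lemma finite_zeros_factorization:
  assumes S: "open S" and f: "f holomorphic_on S" and F: "finite F"
    and Z: "\<And>k. k \<in> F \<Longrightarrow> Z k \<in> S"
    and mult: "\<And>w. w \<in> S \<Longrightarrow> int (card {k\<in>F. Z k = w}) \<le> zorder f w"
  obtains g where "g holomorphic_on S" "\<And>z. z \<in> S \<Longrightarrow> f z = (\<Prod>k\<in>F. z - Z k) * g z"
proof -
  have "\<exists>g. g holomorphic_on S \<and> (\<forall>z\<in>S. f z = (\<Prod>k\<in>F. z - Z k) * g z)"
    using F Z mult
  proof (induction F rule: finite_induct)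
    case empty
    show ?case using f by auto
  next
    case (insert k F)
    let ?a = "Z k"
    have a: "?a \<in> S" using insert.prems(1) by simp
    have "int (card {j\<in>F. Z j = w}) \<le> zorder f w" if "w \<in> S" for w
    proof -
      have "card {j\<in>F. Z j = w} \<le> card {j\<in>insert k F. Z j = w}"
        using insert.hyps by (intro card_mono) auto
      with insert.prems(2)[OF that] show ?thesis by linarith
    qed
    then obtain g where g: "g holomorphic_on S"
      and fg: "\<And>z. z \<in> S \<Longrightarrow> f z = (\<Prod>k\<in>F. z - Z k) * g z"
      using insert.IH insert.prems(1) by auto
    have ga: "g ?a = 0"
    proof (rule ccontr)
      assume ga: "g ?a \<noteq> 0"
      define n where "n = card {j\<in>F. Z j = ?a}"
      \<comment> \<open>Separating the factors with \<open>Z j = ?a\<close> writes \<open>f\<close>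
        as \<open>G\<close> times the \<open>n\<close>-th power of \<open>w - ?a\<close> with
        \<open>G ?a \<noteq> 0\<close>, so the order is exactly \<open>n\<close>. Together with
        \<open>k\<close> there are \<open>n + 1\<close> indices at \<open>?a\<close>, which
        contradicts the multiplicity hypothesis.\<close>
      define G where "G = (\<lambda>z. (\<Prod>j\<in>{j\<in>F. Z j \<noteq> ?a}. z - Z j) * g z)"
      have "zorder f ?a = int n"
      proof (rule zorder_eqI[OF S a])
        show "G holomorphic_on S"
          unfolding G_def by (intro holomorphic_intros g)
        show "G ?a \<noteq> 0"
          using ga insert.hyps by (auto simp: G_def)
        show "f w = G w * (w - ?a) powi int n" if "w \<in> S" for w
        proof -
          have "(\<Prod>j\<in>F. w - Z j)
              = (\<Prod>j\<in>{j\<in>F. Z j \<noteq> ?a}. w - Z j) * (\<Prod>j\<in>{j\<in>F. Z j = ?a}. w - Z j)"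
            using insert.hyps by (subst prod.union_disjoint[symmetric]) (auto intro!: prod.cong)
          also have "(\<Prod>j\<in>{j\<in>F. Z j = ?a}. w - Z j) = (w - ?a) ^ n"
            by (simp add: n_def)
          finally show ?thesis
            using fg[OF that] by (simp add: G_def)
        qed
      qed
      moreover have "{j\<in>insert k F. Z j = ?a} = insert k {j\<in>F. Z j = ?a}" by auto
      then have "card {j\<in>insert k F. Z j = ?a} = Suc n"
        using insert.hyps by (simp add: n_def)
      ultimately show False
        using insert.prems(2)[OF a] by simp
    qed
    \<comment> \<open>Since \<open>g ?a = 0\<close>, this is \<open>g z / (z - ?a)\<close> with its
      removable singularity filled in.\<close>
    define h where "h = (\<lambda>z. if z = ?a then deriv g ?a else (g z - g ?a) / (z - ?a))"
    have "h holomorphic_on S"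
      unfolding h_def by (rule pole_lemma_open[OF g S])
    moreover have "f z = (\<Prod>j\<in>insert k F. z - Z j) * h z" if "z \<in> S" for z
      using fg[OF that] ga insert.hyps by (simp add: h_def)
    ultimately show ?case by blast
  qed
  with that show thesis by blast
qed

text \<open>Jensen's inequality without integral means: replacing each factor \<open>z - Z k\<close> of \<open>f\<close> by
  \<open>r - cnj (Z k) * z / r\<close> does not change the modulus on the circle of radius \<open>r\<close>, so the
  maximum principle bounds the value at the origin.\<close>

lemma sum_ln_zeros_le:
  assumes f: "f holomorphic_on ball 0 1" and F: "finite F"
    and Z: "\<And>k. k \<in> F \<Longrightarrow> Z k \<in> ball 0 1"
    and mult: "\<And>w. w \<in> ball 0 1 \<Longrightarrow> int (card {k\<in>F. Z k = w}) \<le> zorder f w"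
    and r: "0 < r" "r < 1" and bound: "\<And>z. cmod z = r \<Longrightarrow> cmod (f z) \<le> exp M"
    and f0: "f 0 \<noteq> 0"
  shows "(\<Sum>k\<in>F. ln (r / cmod (Z k))) \<le> M - ln (cmod (f 0))"
proof -
  obtain g where g: "g holomorphic_on ball 0 1"
    and fg: "\<And>z. z \<in> ball 0 1 \<Longrightarrow> f z = (\<Prod>k\<in>F. z - Z k) * g z"
    using finite_zeros_factorization[OF open_ball f F Z mult] by metis
  \<comment> \<open>All indices in \<open>F\<close> are treated alike: the moduli agree on the
    circle also when \<open>r \<le> cmod (Z k)\<close>, and such points merely contribute
    nonpositive terms to the final sum.\<close>
  define h where "h = (\<lambda>z. (\<Prod>k\<in>F. of_real r - cnj (Z k) * z / of_real r) * g z)"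
  have h: "h holomorphic_on ball 0 1"
    unfolding h_def using r by (intro holomorphic_intros g) auto
  have factor: "cmod (of_real r - cnj a * z / of_real r) = cmod (z - a)" if "cmod z = r" for a z
  proof -
    have "of_real r = z * cnj z / of_real r"
      using that r by (simp add: complex_norm_square[symmetric] power2_eq_square)
    then have "of_real r - cnj a * z / of_real r = (z / of_real r) * cnj (z - a)"
      by (metis (no_types, opaque_lifting) complex_cnj_diff diff_divide_distrib mult.commute
          right_diff_distrib times_divide_eq_left)
    then have "cmod (of_real r - cnj a * z / of_real r) = cmod z / r * cmod (z - a)"
      using r by (simp add: norm_mult norm_divide flip: complex_cnj_diff)
    then show ?thesis using that r by simp
  qed
  have "cmod (h 0) \<le> exp M"
  proof (rule maximum_modulus_frontier[where f = h and S = "cball 0 r"])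
    show "h holomorphic_on interior (cball 0 r)"
      using r by (intro holomorphic_on_subset[OF h]) auto
    show "continuous_on (closure (cball 0 r)) h"
      using r by (intro continuous_on_subset[OF holomorphic_on_imp_continuous_on[OF h]]) auto
    show "cmod (h z) \<le> exp M" if "z \<in> frontier (cball 0 r)" for z
    proof -
      have z: "cmod z = r" using that r by simp
      have "cmod (h z) = cmod (f z)"
        using fg[of z] z r by (simp add: h_def norm_mult prod_norm[symmetric] factor)
      then show ?thesis using bound[OF z] by simp
    qed
  qed (use r in auto)
  then have h0: "r ^ card F * cmod (g 0) \<le> exp M"
    using r by (simp add: h_def norm_mult norm_power)
  have f0_eq: "cmod (f 0) = (\<Prod>k\<in>F. cmod (Z k)) * cmod (g 0)"
    using fg[of 0] by (simp add: norm_mult prod_norm[symmetric])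
  \<comment> \<open>As \<open>f 0 \<noteq> 0\<close>, no \<open>Z k\<close> is the origin, so the
    logarithms of the quotients and of the product may be split.\<close>
  with f0 have "(\<Prod>k\<in>F. cmod (Z k)) \<noteq> 0" and g0: "0 < cmod (g 0)"
    by auto
  with F have Zpos: "\<And>k. k \<in> F \<Longrightarrow> 0 < cmod (Z k)"
    by auto
  have "(\<Sum>k\<in>F. ln (r / cmod (Z k))) = card F * ln r - (\<Sum>k\<in>F. ln (cmod (Z k)))"
    using r Zpos by (simp add: ln_div sum_subtractf)
  also have "(\<Sum>k\<in>F. ln (cmod (Z k))) = ln (cmod (f 0)) - ln (cmod (g 0))"
    using Zpos g0 F prod_pos[of F "\<lambda>k. cmod (Z k)"] by (simp add: f0_eq ln_mult ln_prod)
  finally have "(\<Sum>k\<in>F. ln (r / cmod (Z k))) = card F * ln r + ln (cmod (g 0)) - ln (cmod (f 0))"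
    by simp
  moreover have "card F * ln r + ln (cmod (g 0)) \<le> M"
    using h0 r g0 by (simp add: ln_mult ln_realpow flip: ln_le_cancel_iff[of _ "exp M"])
  ultimately show ?thesis by simp
qed

section \<open>Right derivatives and the increments of the majorant\<close>

lemma has_right_deriv:
  assumes "admissible_majorant r0 m" "r0 \<le> r" "r < 1"
  shows "(m has_real_derivative right_deriv m r) (at_right r)"
proof -
  obtain D where D: "(m has_real_derivative D) (at_right r)"
    using assms unfolding admissible_majorant_def by (meson atLeastLessThan_iff)
  moreover have "E = D" if "(m has_real_derivative E) (at_right r)" for E
    using that D by (auto simp: has_field_derivative_iff intro: tendsto_unique[OF trivial_limit_at_right_real])
  ultimately show ?thesis
    unfolding right_deriv_def by (rule theI)
qed

lemma right_deriv_nonneg: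
  assumes adm: "admissible_majorant r0 m" and r: "r0 \<le> r" "r < 1"
  shows "0 \<le> right_deriv m r"
proof -
  have lim: "((\<lambda>t. (m t - m r) / (t - r)) \<longlongrightarrow> right_deriv m r) (at_right r)"
    using has_right_deriv[OF assms] by (simp add: has_field_derivative_iff)
  have "\<forall>\<^sub>F t in at_right r. 0 \<le> (m t - m r) / (t - r)"
    using eventually_at_right_less[of r] eventually_at_right_real[OF r(2)]
  proof eventually_elim
    case (elim t)
    then have "m r \<le> m t"
      using adm r by (auto simp: admissible_majorant_def intro!: mono_onD[of "{r0..<1}" m])
    with elim show ?case by simp
  qed
  then show ?thesis
    by (rule tendsto_lowerbound[OF lim]) simp
qed

text \<open>With a one-sided derivative the mean value theorem is replaced by a last-point argument:
  after subtracting a line of small slope \<open>c\<close>, the right derivative is negative, so the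
  set where the tilted function is at most 0 cannot end before \<open>y\<close>.\<close>

lemma right_deriv_zero_imp_le:
  fixes g :: "real \<Rightarrow> real"
  assumes "x \<le> y" and cont: "continuous_on {x..y} g"
    and deriv: "\<And>u. x \<le> u \<Longrightarrow> u < y \<Longrightarrow> (g has_real_derivative 0) (at_right u)"
  shows "g y \<le> g x"
proof (rule field_le_epsilon)
  fix e :: real assume e: "0 < e"
  \<comment> \<open>The summand 1 allows \<open>x = y\<close>; the total tilt
    \<open>c * (y - x)\<close> stays below \<open>e\<close>.\<close>
  define c where "c = e / (y - x + 1)"
  have c: "0 < c" using e \<open>x \<le> y\<close> by (simp add: c_def)
  define h where "h = (\<lambda>t. g t - g x - c * (t - x))"
  have "h y \<le> 0"
  proof (rule ccontr)
    assume hy: "\<not> h y \<le> 0"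
    define A where "A = {x..y} \<inter> h -` {..0}"
    have "continuous_on {x..y} h"
      unfolding h_def by (intro continuous_intros cont)
    then have "closed A"
      unfolding A_def by (intro continuous_closed_preimage) auto
    then have "compact A"
      unfolding A_def by (metis compact_Int_closed compact_Icc inf.left_idem)
    moreover have "x \<in> A" using \<open>x \<le> y\<close> by (simp add: A_def h_def)
    \<comment> \<open>At the last point \<open>u\<close> of \<open>A\<close> the function
      \<open>h\<close> is at most 0 and strictly smaller just to the right, so \<open>A\<close> has
      a later point.\<close>
    ultimately obtain u where u: "u \<in> A" "\<And>t. t \<in> A \<Longrightarrow> t \<le> u"
      using compact_attains_sup[of A] by blast
    have uy: "x \<le> u" "u < y"
      using u(1) hy by (auto simp: A_def less_le)
    have "(h has_real_derivative - c) (at_right u)"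
      unfolding h_def by (auto intro!: derivative_eq_intros deriv uy)
    then have "((\<lambda>t. (h t - h u) / (t - u)) \<longlongrightarrow> - c) (at_right u)"
      by (simp add: has_field_derivative_iff)
    then have "\<forall>\<^sub>F t in at_right u. (h t - h u) / (t - u) < 0"
      using c by (intro order_tendstoD) auto
    then have "\<forall>\<^sub>F t in at_right u. False"
      using eventually_at_right_less[of u] eventually_at_right_real[OF uy(2)]
    proof eventually_elim
      case (elim t)
      then have "h t < h u" by (simp add: divide_less_0_iff)
      then have "t \<in> A" using u(1) uy elim by (auto simp: A_def)
      then show ?case using u(2)[of t] elim by simp
    qed
    then show False by simp
  qed
  moreover have "c * (y - x) \<le> e"
    using e \<open>x \<le> y\<close> by (simp add: c_def field_simps)
  ultimately show "g y \<le> g x + e"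
    by (simp add: h_def)
qed

text \<open>The right derivative need not be monotone, but its product with \<open>t\<close> is, and
  monotone functions are Borel.\<close>

lemma right_deriv_measurable:
  assumes adm: "admissible_majorant r0 m"
  shows "(\<lambda>t. indicator {r0..<1} t * right_deriv m t) \<in> borel_measurable borel"
proof -
  have "(\<lambda>t. t * right_deriv m t) \<in> borel_measurable (restrict_space borel {r0..<1})"
    using adm by (intro borel_measurable_mono_on_fnc) (simp add: admissible_majorant_def)
  then have [measurable]: "(\<lambda>t. indicator {r0..<1} t * (t * right_deriv m t)) \<in> borel_measurable borel"
    by (subst (asm) borel_measurable_restrict_space_iff) auto
  \<comment> \<open>The sign of \<open>r0\<close> is free here, so 0 may lie in the interval;
    multiplying and dividing by \<open>t\<close> would lose the value there.\<close>
  have "(\<lambda>t. if t = 0 then indicator {r0..<1} 0 * right_deriv m 0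
      else indicator {r0..<1} t * (t * right_deriv m t) / t) \<in> borel_measurable borel"
    by measurable
  then show ?thesis
    by (rule measurable_cong[THEN iffD1, rotated]) auto
qed

text \<open>A one-sided fundamental theorem of calculus: by right-continuity, \<open>m\<close> and
  the indefinite integral of its right derivative have the same right derivative, so their
  difference does not increase.\<close>

lemma majorant_increment_le:
  assumes adm: "admissible_majorant r0 m" and r0: "0 < r0" and xy: "r0 \<le> x" "x \<le> y" "y < 1"
  shows "ennreal (m y - m x) \<le> (\<integral>\<^sup>+t\<in>{x..<y}. ennreal (right_deriv m t) \<partial>lborel)"
proof -
  define p where "p = right_deriv m"
  define P where "P = (\<lambda>t. indicator {r0..<1} t * p t)"
  have [measurable]: "P \<in> borel_measurable borel"
    unfolding P_def p_def by (rule right_deriv_measurable[OF adm])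
  have P: "P t = p t" if "x \<le> t" "t \<le> y" for t
    using that xy by (simp add: P_def)
  have p_nonneg: "0 \<le> p t" if "x \<le> t" "t \<le> y" for t
    unfolding p_def using that xy by (intro right_deriv_nonneg[OF adm]) auto
  \<comment> \<open>Monotonicity of \<open>t * p t\<close> bounds \<open>p\<close> on the compact
    interval, which gives integrability.\<close>
  have p_bound: "p t \<le> y * p y / x" if "x \<le> t" "t \<le> y" for t
  proof -
    have "t * p t \<le> y * p y"
      using adm that xy unfolding admissible_majorant_def p_def
      by (intro mono_onD[of "{r0..<1}" "\<lambda>r. r * right_deriv m r"]) auto
    moreover have "x * p t \<le> t * p t"
      using that p_nonneg by (intro mult_right_mono) auto
    ultimately show ?thesis using xy r0 by (simp add: field_simps)
  qed
  have "set_integrable lborel {x..y} P"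
    unfolding set_integrable_def
  proof (rule integrableI_bounded_set_indicator)
    show "AE t\<in>{x..y} in lborel. norm (P t) \<le> y * p y / x"
      using p_bound p_nonneg P by auto
  next
    show "emeasure lborel {x..y} < \<infinity>"
      by (intro emeasure_bounded_finite) simp
  qed auto
  then have "P integrable_on {x..y}"
    by (rule set_borel_integral_eq_integral)
  then have int: "p integrable_on {x..y}"
    by (rule integrable_eq) (simp add: P)
  define I where "I = (\<lambda>u. integral {x..u} p)"
  have "m y - I y \<le> m x - I x"
  proof (rule right_deriv_zero_imp_le[of x y "\<lambda>u. m u - I u", OF xy(2)])
    have "continuous_on {x..y} m"
      using adm xy by (auto simp: admissible_majorant_def elim: continuous_on_subset)
    moreover have "continuous_on {x..y} I"
      unfolding I_def by (rule indefinite_integral_continuous_1[OF int])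
    ultimately show "continuous_on {x..y} (\<lambda>u. m u - I u)"
      by (rule continuous_on_diff)
    show "((\<lambda>u. m u - I u) has_real_derivative 0) (at_right u)" if u: "x \<le> u" "u < y" for u
    proof -
      have intu: "p integrable_on {u..y}"
        using int u by (auto intro: integrable_on_subinterval)
      have at: "at u within {u..y} = at_right u"
        using u by (intro at_within_Icc_at_right)
      \<comment> \<open>Right-continuity at \<open>u\<close> is continuity within
        \<open>{u..y}\<close>, which suffices to differentiate the integral at its left
        endpoint.\<close>
      have "continuous (at_right u) p"
        using adm u xy by (auto simp: admissible_majorant_def p_def)
      then have "((\<lambda>v. integral {u..v} p) has_vector_derivative p u) (at_right u)"
        using integral_has_vector_derivative_continuous_at[OF intu, of u "{}"] u by (simp add: at)
      then have "((\<lambda>v. I u + integral {u..v} p) has_real_derivative p u) (at_right u)"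
        by (auto simp: has_real_derivative_iff_has_vector_derivative intro!: derivative_eq_intros)
      moreover have "\<forall>\<^sub>F v in at_right u. I u + integral {u..v} p = I v"
        using eventually_at_right_real[OF u(2)]
      proof eventually_elim
        case (elim v)
        then show ?case
          unfolding I_def using u int
          by (intro Henstock_Kurzweil_Integration.integral_combine) (auto intro: integrable_on_subinterval)
      qed
      ultimately have "(I has_real_derivative p u) (at_right u)"
        using u by (subst (asm) has_field_derivative_cong_eventually) (auto simp: I_def)
      moreover have "(m has_real_derivative p u) (at_right u)"
        unfolding p_def using u xy by (intro has_right_deriv[OF adm]) auto
      ultimately show ?thesis
        by (auto intro!: derivative_eq_intros)
    qed
  qed
  then have "m y - m x \<le> integral {x..y} p"
    by (simp add: I_def)
  then have "ennreal (m y - m x) \<le> ennreal (integral {x..y} p)"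
    by (rule ennreal_leI)
  also have "\<dots> = (\<integral>\<^sup>+t. ennreal (indicator {x..y} t * p t) \<partial>lborel)"
    using p_nonneg integrable_integral[OF int]
    by (intro nn_integral_has_integral_lebesgue[symmetric]) auto
  also have "\<dots> = (\<integral>\<^sup>+t\<in>{x..<y}. ennreal (p t) \<partial>lborel)"
  proof (rule nn_integral_cong_AE)
    have "AE t in lborel. t \<noteq> y" by (rule AE_lborel_singleton)
    then show "AE t in lborel. ennreal (indicator {x..y} t * p t) = ennreal (p t) * indicator {x..<y} t"
      by eventually_elim (auto simp: indicator_def)
  qed
  finally show ?thesis by (simp add: p_def)
qed

section \<open>Integration against a decreasing weight\<close>

text \<open>Being closed downwards, \<open>A\<close> is an interval from \<open>a\<close> to its
  supremum up to a null set. The supremum may equal \<open>e\<close>, where \<open>bound\<close>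
  says nothing, so the interval is exhausted from the left.\<close>

lemma nn_integral_level_set_le:
  fixes g h :: "real \<Rightarrow> ennreal"
  assumes [measurable]: "g \<in> borel_measurable borel" "h \<in> borel_measurable borel"
    and bound: "\<And>\<rho>. a < \<rho> \<Longrightarrow> \<rho> < e \<Longrightarrow>
      (\<integral>\<^sup>+t\<in>{a..<\<rho>}. g t \<partial>lborel) \<le> c + (\<integral>\<^sup>+t\<in>{a..<\<rho>}. h t \<partial>lborel)"
    and A: "A \<subseteq> {a..<e}" "a \<in> A"
    and down: "\<And>s t. t \<in> A \<Longrightarrow> a \<le> s \<Longrightarrow> s \<le> t \<Longrightarrow> s \<in> A"
  shows "(\<integral>\<^sup>+t\<in>A. g t \<partial>lborel) \<le> c + (\<integral>\<^sup>+t\<in>A. h t \<partial>lborel)"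
proof -
  define \<rho> where "\<rho> = Sup A"
  have bdd: "bdd_above A" using A(1) by (rule bdd_above_mono[rotated]) simp
  have a\<rho>: "a \<le> \<rho>" unfolding \<rho>_def by (rule cSup_upper[OF A(2) bdd])
  have \<rho>e: "\<rho> \<le> e"
    unfolding \<rho>_def using A by (intro cSup_least) auto
  have sub: "{a..<\<rho>} \<subseteq> A"
  proof
    fix t assume t: "t \<in> {a..<\<rho>}"
    then obtain s where "s \<in> A" "t < s"
      using less_cSup_iff[of A t] A(2) bdd by (auto simp: \<rho>_def)
    then show "t \<in> A" using down[of s t] t by simp
  qed
  have sup: "A \<subseteq> {a..\<rho>}"
  proof
    fix t assume "t \<in> A"
    with A(1) cSup_upper[OF this bdd] show "t \<in> {a..\<rho>}" by (auto simp: \<rho>_def)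
  qed
  have level: "(\<integral>\<^sup>+t\<in>A. u t \<partial>lborel) = (\<integral>\<^sup>+t\<in>{a..<\<rho>}. u t \<partial>lborel)" for u :: "real \<Rightarrow> ennreal"
  proof (rule nn_integral_cong_AE)
    have "AE t in lborel. t \<noteq> \<rho>" by (rule AE_lborel_singleton)
    then show "AE t in lborel. u t * indicator A t = u t * indicator {a..<\<rho>} t"
    proof eventually_elim
      case (elim t)
      then have "t \<in> A \<longleftrightarrow> t \<in> {a..<\<rho>}" using sub sup by fastforce
      then show ?case by (simp add: indicator_def)
    qed
  qed
  show ?thesis
  proof (cases "a = \<rho>")
    case True
    then show ?thesis by (simp add: level)
  next
    case False
    with a\<rho> have "a < \<rho>" by simp
    \<comment> \<open>The shift is 2 because with 1 the first term would be \<open>a\<close> itself,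
      which \<open>bound\<close> excludes.\<close>
    define r where "r = (\<lambda>n. \<rho> - (\<rho> - a) / real (n + 2))"
    have r: "a < r n" "r n < \<rho>" for n
      using \<open>a < \<rho>\<close> by (auto simp: r_def field_simps intro!: add_less_le_mono mult_right_mono)
    have r_mono: "r i \<le> r j" if "i \<le> j" for i j
      unfolding r_def using that \<open>a < \<rho>\<close> by (intro diff_left_mono divide_left_mono) auto
    have Un: "(\<Union>n. {a..<r n}) = {a..<\<rho>}"
    proof
      show "(\<Union>n. {a..<r n}) \<subseteq> {a..<\<rho>}" by (auto intro: order.strict_trans[OF _ r(2)])
      show "{a..<\<rho>} \<subseteq> (\<Union>n. {a..<r n})"
      proof
        fix t assume t: "t \<in> {a..<\<rho>}"
        obtain n where "(\<rho> - a) / (\<rho> - t) < real n" using reals_Archimedean2 by blast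
        then have "(\<rho> - a) / (\<rho> - t) < real (n + 2)" by simp
        then have "t < r n" using t by (simp add: r_def field_simps)
        then show "t \<in> (\<Union>n. {a..<r n})" using t by auto
      qed
    qed
    \<comment> \<open>Continuity from below of the measure with density \<open>g\<close> serves as
      monotone convergence.\<close>
    have "(\<integral>\<^sup>+t\<in>{a..<\<rho>}. g t \<partial>lborel) = emeasure (density lborel g) (\<Union>n. {a..<r n})"
      by (simp add: emeasure_density Un)
    also have "\<dots> = (SUP n. emeasure (density lborel g) {a..<r n})"
      using r_mono by (intro SUP_emeasure_incseq[symmetric])
        (auto simp: incseq_def intro: order_less_le_trans)
    also have "\<dots> \<le> c + (\<integral>\<^sup>+t\<in>{a..<\<rho>}. h t \<partial>lborel)"
    proof (rule SUP_least)
      fix n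
      have "emeasure (density lborel g) {a..<r n} \<le> c + (\<integral>\<^sup>+t\<in>{a..<r n}. h t \<partial>lborel)"
        using bound[of "r n"] r[of n] \<rho>e by (simp add: emeasure_density)
      also have "\<dots> \<le> c + (\<integral>\<^sup>+t\<in>{a..<\<rho>}. h t \<partial>lborel)"
        using r[of n] by (intro add_left_mono nn_set_integral_set_mono) auto
      finally show "emeasure (density lborel g) {a..<r n} \<le> \<dots>" .
    qed
    finally show ?thesis by (simp add: level)
  qed
qed

text \<open>Layer-cake form of integration by parts: the superlevel sets of a decreasing weight are
  initial intervals, on which the hypothesis applies.\<close>

lemma nn_integral_antimono_weight_le:
  fixes d :: "real \<Rightarrow> real" and g h :: "real \<Rightarrow> ennreal"
  assumes "a < e" and [measurable]: "g \<in> borel_measurable borel" "h \<in> borel_measurable borel"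
    and meas: "(\<lambda>t. indicator {a..<e} t * d t) \<in> borel_measurable borel"
    and nonneg: "\<And>t. t \<in> {a..<e} \<Longrightarrow> 0 \<le> d t" and anti: "antimono_on {a..<e} d"
    and bound: "\<And>\<rho>. a < \<rho> \<Longrightarrow> \<rho> < e \<Longrightarrow>
      (\<integral>\<^sup>+t\<in>{a..<\<rho>}. g t \<partial>lborel) \<le> c + (\<integral>\<^sup>+t\<in>{a..<\<rho>}. h t \<partial>lborel)"
  shows "(\<integral>\<^sup>+t\<in>{a..<e}. ennreal (d t) * g t \<partial>lborel)
    \<le> ennreal (d a) * c + (\<integral>\<^sup>+t\<in>{a..<e}. ennreal (d t) * h t \<partial>lborel)"
proof -
  define D where "D = (\<lambda>t. indicator {a..<e} t * d t)"
  have [measurable]: "D \<in> borel_measurable borel"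
    unfolding D_def by (rule meas)
  \<comment> \<open>The condition \<open>0 \<le> s\<close> makes the levels \<open>s\<close> with
    \<open>t \<in> L s\<close> form \<open>{0..<D t}\<close>, of length \<open>D t\<close>; Fubini
    then yields the layer-cake formula \<open>cake\<close>.\<close>
  define L where "L = (\<lambda>s. {t. 0 \<le> s \<and> s < D t})"
  have L_meas [measurable]: "Measurable.pred (lborel \<Otimes>\<^sub>M lborel) (\<lambda>(t, s). t \<in> L s)"
    unfolding L_def by simp measurable
  have D_nonneg: "0 \<le> D t" for t
    using nonneg by (simp add: D_def indicator_def)
  have cake: "(\<integral>\<^sup>+t\<in>{a..<e}. ennreal (d t) * u t \<partial>lborel) = (\<integral>\<^sup>+s. (\<integral>\<^sup>+t\<in>L s. u t \<partial>lborel) \<partial>lborel)"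
    if [measurable]: "u \<in> borel_measurable borel" for u :: "real \<Rightarrow> ennreal"
  proof -
    have "(\<integral>\<^sup>+t\<in>{a..<e}. ennreal (d t) * u t \<partial>lborel) = (\<integral>\<^sup>+t. u t * emeasure lborel {0..<D t} \<partial>lborel)"
      using D_nonneg by (intro nn_integral_cong) (auto simp: D_def indicator_def mult.commute)
    also have "\<dots> = (\<integral>\<^sup>+t. (\<integral>\<^sup>+s. u t * indicator {0..<D t} s \<partial>lborel) \<partial>lborel)"
      by (intro nn_integral_cong) (simp add: nn_integral_cmult_indicator)
    also have "\<dots> = (\<integral>\<^sup>+t. (\<integral>\<^sup>+s. u t * indicator (L s) t \<partial>lborel) \<partial>lborel)"
      by (intro nn_integral_cong) (simp add: L_def indicator_def)
    also have "\<dots> = (\<integral>\<^sup>+s. (\<integral>\<^sup>+t. u t * indicator (L s) t \<partial>lborel) \<partial>lborel)"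
      by (rule lborel_pair.Fubini') measurable
    finally show ?thesis .
  qed
  \<comment> \<open>The constant \<open>c\<close> is paid only at levels below \<open>d a\<close>,
    the largest value of the weight; all other level sets are empty. Integrating over
    \<open>s\<close> gives \<open>d a * c\<close>.\<close>
  have "(\<integral>\<^sup>+t\<in>L s. g t \<partial>lborel) \<le> c * indicator {0..<d a} s + (\<integral>\<^sup>+t\<in>L s. h t \<partial>lborel)" for s
  proof (cases "s \<in> {0..<d a}")
    case True
    have L_iff: "t \<in> L s \<longleftrightarrow> t \<in> {a..<e} \<and> s < d t" for t
      using True by (auto simp: L_def D_def indicator_def)
    have "(\<integral>\<^sup>+t\<in>L s. g t \<partial>lborel) \<le> c + (\<integral>\<^sup>+t\<in>L s. h t \<partial>lborel)"
    proof (rule nn_integral_level_set_le[where e = e])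
      show "v \<in> L s" if "t \<in> L s" "a \<le> v" "v \<le> t" for v t
        using that monotone_onD[OF anti, of v t] by (auto simp: L_iff)
      show "(\<integral>\<^sup>+t\<in>{a..<\<rho>}. g t \<partial>lborel) \<le> c + (\<integral>\<^sup>+t\<in>{a..<\<rho>}. h t \<partial>lborel)"
        if "a < \<rho>" "\<rho> < e" for \<rho>
        using that by (rule bound)
      show "L s \<subseteq> {a..<e}" by (auto simp: L_iff)
      show "a \<in> L s" using True \<open>a < e\<close> by (simp add: L_iff)
    qed fact+
    with True show ?thesis by simp
  next
    case False
    have "t \<notin> L s" for t
    proof
      assume "t \<in> L s"
      then have "0 \<le> s" "t \<in> {a..<e}" "s < d t"
        by (cases "t \<in> {a..<e}"; force simp: L_def D_def)+
      then show False using False monotone_onD[OF anti, of a t] \<open>a < e\<close> by auto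
    qed
    then show ?thesis by (simp add: indicator_def)
  qed
  then have "(\<integral>\<^sup>+t\<in>{a..<e}. ennreal (d t) * g t \<partial>lborel)
      \<le> (\<integral>\<^sup>+s. c * indicator {0..<d a} s + (\<integral>\<^sup>+t\<in>L s. h t \<partial>lborel) \<partial>lborel)"
    by (simp add: cake nn_integral_mono)
  also have "\<dots> = (\<integral>\<^sup>+s. c * indicator {0..<d a} s \<partial>lborel) + (\<integral>\<^sup>+s. (\<integral>\<^sup>+t\<in>L s. h t \<partial>lborel) \<partial>lborel)"
    by (rule nn_integral_add) measurable
  also have "(\<integral>\<^sup>+s. c * indicator {0..<d a} s \<partial>lborel) = ennreal (d a) * c"
    using nonneg[of a] \<open>a < e\<close> by (simp add: nn_integral_cmult_indicator mult.commute)
  finally show ?thesis by (simp add: cake)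
qed

section \<open>The estimate for finitely many zeros\<close>

lemma nn_integral_inverse:
  assumes "0 < x" "x \<le> y"
  shows "(\<integral>\<^sup>+t\<in>{x..<y}. ennreal (1 / t) \<partial>lborel) = ennreal (ln (y / x))"
proof -
  have "(\<integral>\<^sup>+t\<in>{x..<y}. ennreal (1 / t) \<partial>lborel) = (\<integral>\<^sup>+t\<in>{x..y}. ennreal (1 / t) \<partial>lborel)"
  proof (rule nn_integral_cong_AE)
    have "AE t in lborel. t \<noteq> y" by (rule AE_lborel_singleton)
    then show "AE t in lborel. ennreal (1 / t) * indicator {x..<y} t = ennreal (1 / t) * indicator {x..y} t"
      by eventually_elim (auto simp: indicator_def)
  qed
  also have "\<dots> = ennreal (ln y - ln x)"
    using assms by (intro nn_integral_FTC_Icc)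
      (auto intro!: derivative_eq_intros simp: has_field_derivative_def simp flip: has_field_derivative_def)
  also have "ln y - ln x = ln (y / x)"
    using assms by (simp add: ln_div)
  finally show ?thesis .
qed

text \<open>Of the two error terms, the one with \<open>ln (r2 / r1)\<close> pays for the zeros in
  \<open>|z| < r1\<close>, the one with \<open>ln (r1 / r0)\<close> for the boundary term at
  \<open>r1\<close>.\<close>

lemma finite_sum_weight_tail_le:
  assumes r: "0 < r0" "r0 < r1" "r1 < r2" "r2 < 1" and b: "0 \<le> b"
    and adm: "admissible_majorant r0 m" and d: "d \<in> decr_plus r0 b"
    and f: "f holomorphic_on ball 0 1" and f0: "f 0 \<noteq> 0"
    and bound: "\<And>z. r0 \<le> cmod z \<Longrightarrow> cmod z < 1 \<Longrightarrow> cmod (f z) \<le> exp (m (cmod z))"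
    and F: "finite F" and Z: "\<And>k. k \<in> F \<Longrightarrow> r0 \<le> cmod (Z k) \<and> cmod (Z k) < 1"
    and mult: "\<And>w. w \<in> ball 0 1 \<Longrightarrow> int (card {k\<in>F. Z k = w}) \<le> zorder f w"
  shows "(\<Sum>k\<in>F. weight_tail d (cmod (Z k))) \<le>
      (\<integral>\<^sup>+t\<in>{r0..<1}. ennreal (d t * right_deriv m t) \<partial>lborel)
      + ennreal (b / ln (r2 / r1) * (m r2 - ln (cmod (f 0))) + b / ln (r1 / r0) * (m r1 - ln (cmod (f 0))))"
proof -
  define L where "L = ln (cmod (f 0))"
  define \<rho> where "\<rho> = (\<lambda>k. cmod (Z k))"
  have \<rho>: "r0 \<le> \<rho> k" "\<rho> k < 1" "0 < \<rho> k" if "k \<in> F" for k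
    using Z[OF that] r by (auto simp: \<rho>_def)
  have jensen: "(\<Sum>k\<in>G. ln (s / \<rho> k)) \<le> m s - L" if "G \<subseteq> F" "r0 \<le> s" "s < 1" for G s
    unfolding L_def \<rho>_def
  proof (rule sum_ln_zeros_le[OF f _ _ _ _ _ _ f0])
    show "finite G" using F that(1) by (rule finite_subset[rotated])
    show "int (card {k\<in>G. Z k = w}) \<le> zorder f w" if "w \<in> ball 0 1" for w
    proof -
      have "card {k\<in>G. Z k = w} \<le> card {k\<in>F. Z k = w}"
        using F \<open>G \<subseteq> F\<close> by (intro card_mono) auto
      with mult[OF that] show ?thesis by linarith
    qed
  qed (use that r Z bound in auto)
  \<comment> \<open>With no zeros Jensen's inequality reduces to the maximum principle at the
    origin.\<close>
  have L_le: "L \<le> m s" if "r0 \<le> s" "s < 1" for s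
    using jensen[of "{}" s] that by simp

  from d obtain rd where rd: "rd < r0"
    and nonneg: "\<And>t. rd \<le> t \<Longrightarrow> t < 1 \<Longrightarrow> 0 \<le> d t" and anti: "antimono_on {rd..<1} d"
    and tail: "weight_tail d r0 \<le> ennreal b"
    by (auto simp: decr_plus_def)
  have d_nonneg: "0 \<le> d t" if "r0 \<le> t" "t < 1" for t
    using nonneg[of t] rd that by simp
  have d_anti: "antimono_on {r0..<1} d"
    using anti rd by (auto intro: monotone_on_subset)
  \<comment> \<open>Outside the interval \<open>d\<close> is arbitrary; the cut-off version is Borel
    because \<open>d\<close> is monotone on the interval.\<close>
  define D where "D = (\<lambda>t. indicator {r0..<1} t * d t)"
  have "mono_on {r0..<1} (\<lambda>t. - d t)"
    using d_anti by (auto simp: monotone_on_def)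
  then have "(\<lambda>t. - d t) \<in> borel_measurable (restrict_space borel {r0..<1})"
    by (rule borel_measurable_mono_on_fnc)
  then have "(\<lambda>t. - (indicator {r0..<1} t * - d t)) \<in> borel_measurable borel"
    by (subst (asm) borel_measurable_restrict_space_iff) auto
  then have D_meas [measurable]: "D \<in> borel_measurable borel"
    by (simp add: D_def)
  have D: "D t = d t" if "r0 \<le> t" "t < 1" for t
    using that by (simp add: D_def)
  have D_nonneg: "0 \<le> D t" for t
    using d_nonneg by (simp add: D_def indicator_def)
  have first: "(\<integral>\<^sup>+t\<in>{r0..<r1}. ennreal (D t / t) \<partial>lborel) \<le> ennreal b"
  proof -
    have "(\<integral>\<^sup>+t\<in>{r0..<r1}. ennreal (D t / t) \<partial>lborel) \<le> weight_tail d r0"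
      unfolding weight_tail_def using r by (intro nn_integral_mono) (auto simp: indicator_def D)
    with tail show ?thesis by simp
  qed

  have ln_pos: "0 < ln (r1 / r0)" "0 < ln (r2 / r1)"
    using r by simp_all
  \<comment> \<open>Since \<open>d\<close> decreases, \<open>d r1 / t\<close> is at most
    \<open>d t / t\<close> on \<open>[r0, r1)\<close>, where the latter has integral at most
    \<open>b\<close>.\<close>
  have d_r1: "d r1 \<le> b / ln (r1 / r0)"
  proof -
    have "ennreal (d r1 * ln (r1 / r0)) = ennreal (d r1) * (\<integral>\<^sup>+t\<in>{r0..<r1}. ennreal (1 / t) \<partial>lborel)"
      using r d_nonneg[of r1] by (simp only: nn_integral_inverse) (simp add: ennreal_mult')
    also have "\<dots> = (\<integral>\<^sup>+t. ennreal (d r1) * (ennreal (1 / t) * indicator {r0..<r1} t) \<partial>lborel)"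
      by (rule nn_integral_cmult[symmetric]) measurable
    also have "\<dots> \<le> (\<integral>\<^sup>+t\<in>{r0..<r1}. ennreal (D t / t) \<partial>lborel)"
    proof (rule nn_integral_mono)
      fix t
      show "ennreal (d r1) * (ennreal (1 / t) * indicator {r0..<r1} t)
          \<le> ennreal (D t / t) * indicator {r0..<r1} t"
      proof (cases "t \<in> {r0..<r1}")
        case True
        then have "d r1 \<le> d t" using monotone_onD[OF d_anti, of t r1] r by auto
        then show ?thesis
          using True r d_nonneg[of r1] by (auto simp: D intro!: ennreal_leI divide_right_mono simp flip: ennreal_mult)
      qed simp
    qed
    also note first
    finally have "d r1 * ln (r1 / r0) \<le> b" using b by simp
    then show ?thesis using ln_pos by (simp add: field_simps)
  qed

  define N where "N = {k\<in>F. \<rho> k < r1}"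
  \<comment> \<open>Each zero in \<open>|z| < r1\<close> contributes at least
    \<open>ln (r2 / r1)\<close> to the Jensen sum at radius \<open>r2\<close>.\<close>
  have N: "real (card N) * b \<le> b / ln (r2 / r1) * (m r2 - L)"
  proof -
    have "real (card N) * ln (r2 / r1) = (\<Sum>k\<in>N. ln (r2 / r1))" by simp
    also have "\<dots> \<le> (\<Sum>k\<in>N. ln (r2 / \<rho> k))"
      using r \<rho> by (intro sum_mono) (auto simp: N_def intro!: divide_left_mono)
    also have "\<dots> \<le> m r2 - L"
      using r by (intro jensen) (auto simp: N_def)
    finally have "real (card N) \<le> (m r2 - L) / ln (r2 / r1)"
      using ln_pos by (simp add: field_simps)
    then have "real (card N) * b \<le> (m r2 - L) / ln (r2 / r1) * b"
      using b by (rule mult_right_mono)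
    then show ?thesis by (simp add: field_simps)
  qed

  \<comment> \<open>Each \<open>u k\<close> integrates from \<open>\<rho> k\<close> to
    \<open>s\<close> to \<open>ln (s / \<rho> k)\<close>, so \<open>g t\<close> is
    \<open>n(t) / t\<close> for the counting function \<open>n\<close> of the family
    \<open>F\<close>.\<close>
  define u where "u = (\<lambda>k t. indicator {\<rho> k..} t * ennreal (1 / t))"
  define g where "g = (\<lambda>t. \<Sum>k\<in>F. u k t)"
  define h where "h = (\<lambda>t. ennreal (indicator {r0..<1} t * right_deriv m t))"
  have [measurable]: "u k \<in> borel_measurable borel" for k
    unfolding u_def by measurable
  have [measurable]: "g \<in> borel_measurable borel" "h \<in> borel_measurable borel"
    unfolding g_def h_def using right_deriv_measurable[OF adm] by measurable

  have tail_le: "weight_tail d (\<rho> k) \<le> ennreal b * indicator N k + (\<integral>\<^sup>+t\<in>{r1..<1}. ennreal (D t) * u k t \<partial>lborel)"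
    if k: "k \<in> F" for k
  proof (cases "k \<in> N")
    case True
    have "weight_tail d (\<rho> k) \<le> (\<integral>\<^sup>+t. ennreal (D t / t) * indicator {r0..<r1} t
        + ennreal (D t) * u k t * indicator {r1..<1} t \<partial>lborel)"
      unfolding weight_tail_def
    proof (rule nn_integral_mono)
      fix t
      show "ennreal (d t / t) * indicator {\<rho> k..<1} t \<le> ennreal (D t / t) * indicator {r0..<r1} t
        + ennreal (D t) * u k t * indicator {r1..<1} t"
        using r \<rho>[OF k] d_nonneg[of t]
        by (auto simp: indicator_def u_def D simp flip: ennreal_mult)
    qed
    also have "\<dots> = (\<integral>\<^sup>+t\<in>{r0..<r1}. ennreal (D t / t) \<partial>lborel)
        + (\<integral>\<^sup>+t\<in>{r1..<1}. ennreal (D t) * u k t \<partial>lborel)"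
      by (rule nn_integral_add) measurable
    also have "\<dots> \<le> ennreal b + (\<integral>\<^sup>+t\<in>{r1..<1}. ennreal (D t) * u k t \<partial>lborel)"
      by (rule add_right_mono[OF first])
    finally show ?thesis using True by simp
  next
    case False
    then have "r1 \<le> \<rho> k" using k by (auto simp: N_def)
    have "weight_tail d (\<rho> k) \<le> (\<integral>\<^sup>+t\<in>{r1..<1}. ennreal (D t) * u k t \<partial>lborel)"
      unfolding weight_tail_def
    proof (rule nn_integral_mono)
      fix t
      show "ennreal (d t / t) * indicator {\<rho> k..<1} t \<le> ennreal (D t) * u k t * indicator {r1..<1} t"
        using r \<open>r1 \<le> \<rho> k\<close> \<rho>[OF k] d_nonneg[of t]
        by (auto simp: indicator_def u_def D simp flip: ennreal_mult)
    qed
    then show ?thesis using False by simp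
  qed

  have second: "(\<integral>\<^sup>+t\<in>{r1..<1}. ennreal (D t) * g t \<partial>lborel)
      \<le> ennreal (D r1) * ennreal (m r1 - L) + (\<integral>\<^sup>+t\<in>{r1..<1}. ennreal (D t) * h t \<partial>lborel)"
  proof (rule nn_integral_antimono_weight_le)
    show "antimono_on {r1..<1} D"
      using d_anti r by (auto simp: monotone_on_def D)
    fix s assume s: "r1 < s" "s < 1"
    have "(\<integral>\<^sup>+t\<in>{r1..<s}. g t \<partial>lborel) = (\<Sum>k\<in>F. \<integral>\<^sup>+t\<in>{r1..<s}. u k t \<partial>lborel)"
      by (simp add: g_def sum_distrib_right nn_integral_sum)
    \<comment> \<open>Extending each integral down to \<open>\<rho> k\<close> produces the Jensen
      sum at radius \<open>s\<close>; points with \<open>s \<le> \<rho> k\<close> give 0.\<close>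
    also have "\<dots> \<le> (\<Sum>k\<in>F. if \<rho> k < s then ennreal (ln (s / \<rho> k)) else 0)"
    proof (rule sum_mono)
      fix k assume k: "k \<in> F"
      have "(\<integral>\<^sup>+t\<in>{r1..<s}. u k t \<partial>lborel) \<le> (\<integral>\<^sup>+t\<in>{\<rho> k..<s}. ennreal (1 / t) \<partial>lborel)"
        by (intro nn_integral_mono) (auto simp: u_def indicator_def)
      also have "\<dots> = (if \<rho> k < s then ennreal (ln (s / \<rho> k)) else 0)"
        using \<rho>[OF k] by (auto simp: nn_integral_inverse)
      finally show "(\<integral>\<^sup>+t\<in>{r1..<s}. u k t \<partial>lborel) \<le> \<dots>" .
    qed
    also have "\<dots> = (\<Sum>k\<in>{k\<in>F. \<rho> k < s}. ennreal (ln (s / \<rho> k)))"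
      using F by (simp add: sum.inter_filter)
    also have "\<dots> = ennreal (\<Sum>k\<in>{k\<in>F. \<rho> k < s}. ln (s / \<rho> k))"
      using \<rho> by (intro sum_ennreal) (auto intro!: ln_ge_zero)
    \<comment> \<open>The part \<open>m r1 - L\<close> is independent of \<open>s\<close> and
      becomes the constant of the integration by parts; the increment of \<open>m\<close> passes
      into the integral of \<open>h\<close>.\<close>
    also have "\<dots> \<le> ennreal ((m r1 - L) + (m s - m r1))"
      using jensen[of "{k\<in>F. \<rho> k < s}" s] r s by (intro ennreal_leI) auto
    also have "\<dots> = ennreal (m r1 - L) + ennreal (m s - m r1)"
    proof (rule ennreal_plus)
      show "0 \<le> m r1 - L" using L_le[of r1] r by simp
      show "0 \<le> m s - m r1"
        using adm r s by (auto simp: admissible_majorant_def intro!: mono_onD[of "{r0..<1}" m])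
    qed
    also have "ennreal (m s - m r1) \<le> (\<integral>\<^sup>+t\<in>{r1..<s}. ennreal (right_deriv m t) \<partial>lborel)"
      using r s by (intro majorant_increment_le[OF adm]) auto
    also have "\<dots> = (\<integral>\<^sup>+t\<in>{r1..<s}. h t \<partial>lborel)"
      using r s by (intro nn_integral_cong) (auto simp: h_def indicator_def)
    finally show "(\<integral>\<^sup>+t\<in>{r1..<s}. g t \<partial>lborel) \<le> ennreal (m r1 - L) + (\<integral>\<^sup>+t\<in>{r1..<s}. h t \<partial>lborel)"
      by (simp add: add_left_mono)
  qed (use r D_nonneg in auto)

  have "(\<Sum>k\<in>F. weight_tail d (\<rho> k))
      \<le> (\<Sum>k\<in>F. ennreal b * indicator N k + (\<integral>\<^sup>+t\<in>{r1..<1}. ennreal (D t) * u k t \<partial>lborel))"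
    by (intro sum_mono tail_le)
  also have "\<dots> = (\<Sum>k\<in>F. ennreal b * indicator N k)
      + (\<Sum>k\<in>F. \<integral>\<^sup>+t\<in>{r1..<1}. ennreal (D t) * u k t \<partial>lborel)"
    by (rule sum.distrib)
  also have "(\<Sum>k\<in>F. ennreal b * indicator N k) = (\<Sum>k\<in>N. ennreal b)"
    using F by (intro sum.mono_neutral_cong_right) (auto simp: N_def)
  also have "\<dots> = ennreal (real (card N) * b)"
    by (simp add: ennreal_mult' ennreal_of_nat_eq_real_of_nat)
  also have "\<dots> \<le> ennreal (b / ln (r2 / r1) * (m r2 - L))"
    by (intro ennreal_leI N)
  also have "(\<Sum>k\<in>F. \<integral>\<^sup>+t\<in>{r1..<1}. ennreal (D t) * u k t \<partial>lborel) = (\<integral>\<^sup>+t\<in>{r1..<1}. ennreal (D t) * g t \<partial>lborel)"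
    by (simp add: g_def sum_distrib_left sum_distrib_right flip: nn_integral_sum)
  also note second
  also have "ennreal (D r1) * ennreal (m r1 - L) = ennreal (d r1 * (m r1 - L))"
    using r d_nonneg[of r1] by (simp add: D ennreal_mult')
  also have "\<dots> \<le> ennreal (b / ln (r1 / r0) * (m r1 - L))"
    using d_r1 L_le[of r1] r by (intro ennreal_leI mult_right_mono) auto
  also have "(\<integral>\<^sup>+t\<in>{r1..<1}. ennreal (D t) * h t \<partial>lborel)
      \<le> (\<integral>\<^sup>+t\<in>{r0..<1}. ennreal (d t * right_deriv m t) \<partial>lborel)"
  proof (rule nn_integral_mono)
    fix t
    show "ennreal (D t) * h t * indicator {r1..<1} t
        \<le> ennreal (d t * right_deriv m t) * indicator {r0..<1} t"
      using r d_nonneg[of t] by (auto simp: indicator_def h_def D ennreal_mult')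
  qed
  finally have "(\<Sum>k\<in>F. weight_tail d (\<rho> k)) \<le> ennreal (b / ln (r2 / r1) * (m r2 - L))
      + (ennreal (b / ln (r1 / r0) * (m r1 - L))
      + (\<integral>\<^sup>+t\<in>{r0..<1}. ennreal (d t * right_deriv m t) \<partial>lborel))"
    by (simp add: add_mono)
  also have "\<dots> = (\<integral>\<^sup>+t\<in>{r0..<1}. ennreal (d t * right_deriv m t) \<partial>lborel)
      + ennreal (b / ln (r2 / r1) * (m r2 - L) + b / ln (r1 / r0) * (m r1 - L))"
    using b ln_pos L_le[of r1] L_le[of r2] r by (subst ennreal_plus) (auto simp: ac_simps)
  finally show ?thesis by (simp add: \<rho>_def L_def)
qed

section \<open>Choice of the constants and passage to all zeros\<close>

theorem mainTheorem9:
  fixes r0 b :: real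
  assumes "0 < r0" and "r0 < 1" and "0 \<le> b"
  shows "\<exists>C::real. 0 \<le> C \<and>
    (\<exists>Cbar :: (real \<Rightarrow> real) \<Rightarrow> real.
      (\<forall>m. admissible_majorant r0 m \<longrightarrow> 0 \<le> Cbar m) \<and>
      (\<forall>m1 m2. (\<forall>r\<in>{r0..<1}. m1 r = m2 r) \<longrightarrow> Cbar m1 = Cbar m2) \<and>
      (\<forall>m a. admissible_majorant r0 m \<and> 0 \<le> a \<longrightarrow> Cbar (\<lambda>r. a * m r) = a * Cbar m) \<and>
      (\<forall>m1 m2. admissible_majorant r0 m1 \<and> admissible_majorant r0 m2 \<longrightarrow>
         Cbar (\<lambda>r. m1 r + m2 r) \<le> Cbar m1 + Cbar m2) \<and>
      (\<forall>m f K Z d.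
         admissible_majorant r0 m \<and>
         f holomorphic_on ball 0 1 \<and> (\<exists>z\<in>ball 0 1. f z \<noteq> 0) \<and>
         disc_sequence K Z \<and> vanishes_on f K Z \<and>
         (\<forall>z\<in>ball 0 1. r0 \<le> cmod z \<longrightarrow> log_abs (f z) \<le> ereal (m (cmod z))) \<and>
         d \<in> decr_plus r0 b \<longrightarrow>
         enn2ereal (\<Sum>\<^sub>\<infinity>k\<in>{k\<in>K. r0 \<le> cmod (Z k) \<and> cmod (Z k) < 1}. weight_tail d (cmod (Z k)))
           \<le> (if f 0 = 0 then \<infinity>
              else enn2ereal (\<integral>\<^sup>+t\<in>{r0..<1}. ennreal (d t * right_deriv m t) \<partial>lborel)
                   + ereal (C * Cbar m) - ereal C * log_abs (f 0))))"
proof -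
  \<comment> \<open>The points \<open>r1\<close> and \<open>r2\<close> cut \<open>[r0, 1]\<close>
    into thirds; any choice depending on \<open>r0\<close> alone keeps \<open>C1\<close> and
    \<open>C2\<close> independent of \<open>m\<close> and \<open>f\<close>.\<close>
  define r1 where "r1 = (2 * r0 + 1) / 3"
  define r2 where "r2 = (r0 + 2) / 3"
  have r: "0 < r0" "r0 < r1" "r1 < r2" "r2 < 1"
    using assms by (auto simp: r1_def r2_def)
  define C1 where "C1 = b / ln (r2 / r1)"
  define C2 where "C2 = b / ln (r1 / r0)"
  have C: "0 \<le> C1" "0 \<le> C2"
    using assms r by (auto simp: C1_def C2_def)
  \<comment> \<open>Evaluation at \<open>r2\<close> is linear in \<open>m\<close>, and the positive
    part is positively homogeneous and subadditive.\<close>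
  define Cbar where "Cbar = (\<lambda>m :: real \<Rightarrow> real. max 0 (m r2))"
  have estimate: "enn2ereal (\<Sum>\<^sub>\<infinity>k\<in>{k\<in>K. r0 \<le> cmod (Z k) \<and> cmod (Z k) < 1}. weight_tail d (cmod (Z k)))
      \<le> enn2ereal (\<integral>\<^sup>+t\<in>{r0..<1}. ennreal (d t * right_deriv m t) \<partial>lborel)
        + ereal ((C1 + C2) * Cbar m) - ereal (C1 + C2) * log_abs (f 0)"
    if adm: "admissible_majorant r0 m" and f: "f holomorphic_on ball 0 1" and f0: "f 0 \<noteq> 0"
      and van: "vanishes_on f K Z"
      and maj: "\<forall>z\<in>ball 0 1. r0 \<le> cmod z \<longrightarrow> log_abs (f z) \<le> ereal (m (cmod z))"
      and d: "d \<in> decr_plus r0 b"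
    for m f K Z d
  proof -
    define L where "L = ln (cmod (f 0))"
    define I where "I = (\<integral>\<^sup>+t\<in>{r0..<1}. ennreal (d t * right_deriv m t) \<partial>lborel)"
    define c where "c = C1 * (m r2 - L) + C2 * (m r1 - L)"
    have bound: "cmod (f z) \<le> exp (m (cmod z))" if "r0 \<le> cmod z" "cmod z < 1" for z
    proof (cases "f z = 0")
      case False
      then have "ln (cmod (f z)) \<le> m (cmod z)"
        using maj that by (auto simp: log_abs_def)
      then show ?thesis using False by (metis exp_le_cancel_iff exp_ln zero_less_norm_iff)
    qed simp
    have "(\<Sum>\<^sub>\<infinity>k\<in>{k\<in>K. r0 \<le> cmod (Z k) \<and> cmod (Z k) < 1}. weight_tail d (cmod (Z k))) \<le> I + ennreal c"
    \<comment> \<open>The bound is uniform over finite subfamilies, so it passes to the infinite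
      sum.\<close>
    proof (rule infsum_le_finite_sums)
      fix F assume F: "finite F" "F \<subseteq> {k\<in>K. r0 \<le> cmod (Z k) \<and> cmod (Z k) < 1}"
      have "int (card {k\<in>F. Z k = w}) \<le> zorder f w" if "w \<in> ball 0 1" for w
      proof -
        have "finite {k\<in>K. Z k = w}" "int (card {k\<in>K. Z k = w}) \<le> zorder f w"
          using van that by (auto simp: vanishes_on_def)
        moreover have "card {k\<in>F. Z k = w} \<le> card {k\<in>K. Z k = w}"
          using F calculation by (intro card_mono) auto
        ultimately show ?thesis by linarith
      qed
      then show "(\<Sum>k\<in>F. weight_tail d (cmod (Z k))) \<le> I + ennreal c"
        unfolding I_def c_def C1_def C2_def L_def using F
        by (intro finite_sum_weight_tail_le[OF r assms(3) adm d f f0 bound]) auto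
    qed (simp add: nonneg_summable_on_complete)
    then have "enn2ereal (\<Sum>\<^sub>\<infinity>k\<in>{k\<in>K. r0 \<le> cmod (Z k) \<and> cmod (Z k) < 1}. weight_tail d (cmod (Z k)))
        \<le> enn2ereal (I + ennreal c)"
      by (simp add: less_eq_ennreal.rep_eq)
    \<comment> \<open>Because \<open>m r1 \<le> m r2 \<le> Cbar m\<close>, both error terms are
      bounded through the same constant; \<open>0 \<le> c\<close> ensures that
      \<open>ennreal c\<close> does not truncate.\<close>
    also have "\<dots> \<le> enn2ereal I + ereal ((C1 + C2) * (Cbar m - L))"
    proof -
      \<comment> \<open>This is the multiplicity hypothesis of Jensen's inequality for the empty
        family.\<close>
      have zorder: "0 \<le> zorder f w" if "w \<in> ball 0 1" for w
        using van that unfolding vanishes_on_def by (meson of_nat_0_le_iff order_trans)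
      have L_le: "L \<le> m s" if "r0 \<le> s" "s < 1" for s
      proof -
        have "cmod (f z) \<le> exp (m s)" if "cmod z = s" for z
          using bound[of z] that \<open>r0 \<le> s\<close> \<open>s < 1\<close> by simp
        with sum_ln_zeros_le[OF f, of "{}" Z s "m s"] show ?thesis
          using zorder that r(1) f0 by (simp add: L_def)
      qed
      have "m r1 \<le> m r2"
        using adm r by (auto simp: admissible_majorant_def intro!: mono_onD[of "{r0..<1}" m])
      then have "c \<le> C1 * (Cbar m - L) + C2 * (Cbar m - L)"
        unfolding c_def Cbar_def using C by (intro add_mono mult_left_mono) auto
      moreover have "0 \<le> c"
        using C L_le[of r1] L_le[of r2] r by (simp add: c_def)
      ultimately show ?thesis
        by (simp add: plus_ennreal.rep_eq add_left_mono algebra_simps)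
    qed
    \<comment> \<open>The case split is there because \<open>I\<close> may be infinite.\<close>
    also have "\<dots> = enn2ereal I + ereal ((C1 + C2) * Cbar m) - ereal (C1 + C2) * log_abs (f 0)"
      using f0 by (cases "enn2ereal I") (auto simp: log_abs_def L_def algebra_simps)
    finally show ?thesis unfolding I_def .
  qed
  show ?thesis
  proof (intro exI[of _ "C1 + C2"] exI[of _ Cbar] conjI allI impI)
    show "Cbar (\<lambda>r. a * m r) = a * Cbar m" if "admissible_majorant r0 m \<and> 0 \<le> a" for m a
      using that by (auto simp: Cbar_def max_def zero_le_mult_iff mult_le_0_iff)
  qed (use C r estimate in \<open>auto simp: Cbar_def\<close>)
qed

end
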